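(* Let $n$ be a positive integer and let $X \in \mathbb{R}^{n \times n}$ be any matrix of rank $2$. Let $X_{n-1}, X_n \in \mathbb{R}^{n \times n}$ be the matrices with entries \[ X_{n-1}(i,j) = X(i,j)^{n-1} \quad\text{and}\quad X_n(i,j) = X(i,j)^n \] for all $1 \le i,j \le n$. Then \[ (n!)^2 \det[X_n] = n^n \, \det[X_{n-1}] \, \mathrm{per}[X]. \]
   Context: For an $n \times n$ matrix $B$, $\mathrm{per}[B] = \sum_{\sigma \in S_n} \prod_{i=1}^n B(i,\sigma(i))$ denotes the permanent, and $\det$ denotes the usual determinant. The matrices $X_{n-1}$ and $X_n$ are entrywise (Hadamard) powers of $X$, not matrix powers. *)

theory Defs
  imports "HOL-Analysis.Analysis"
begin

definition permanent :: "real ^ 'n ^ 'n \<Rightarrow> real" where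
  "permanent B = (\<Sum>\<sigma> | \<sigma> permutes (UNIV :: 'n set). \<Prod>i\<in>UNIV. B $ i $ \<sigma> i)"

definition hadamard_power :: "real ^ 'n ^ 'm \<Rightarrow> nat \<Rightarrow> real ^ 'n ^ 'm" where
  "hadamard_power A k = (\<chi> i j. (A $ i $ j) ^ k)"

end

theory Submission
  imports Defs
begin

text \<open>A matrix of rank two has entries \<open>a i * b j + c i * d j\<close>. If no \<open>c i\<close>, \<open>d j\<close> vanishes, rescaling rows
and columns reduces to \<open>1 + x i * y j\<close>; the general case follows by perturbing \<open>c\<close> and \<open>d\<close>, since
both sides are continuous. For \<open>1 + x i * y j\<close>, the binomial theorem factors the power \<open>n - 1\<close> as
\<open>V x ** D ** transpose (V y)\<close> with \<open>V\<close> a Vandermonde matrix and \<open>D\<close> diagonal. For the power \<open>n\<close> there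
is one additional term \<open>(x i * y j) ^ n\<close>; as \<open>x i\<close> is a root of \<open>\<Prod>j. (t - x j)\<close>, the column \<open>x i ^ n\<close> is \<open>V x\<close>
applied to the vector of signed elementary symmetric functions of \<open>x\<close>, so the middle factor becomes
a diagonal matrix plus one of rank one. The signs cancel in its determinant, which is therefore
proportional to \<open>\<Sum>m. e m x * e m y / (n choose m)\<close> with \<open>e m\<close> the elementary symmetric functions, and
expanding the permanent gives \<open>n!\<close> times the same sum.\<close>

section \<open>Determinant of a diagonal matrix plus a rank-one matrix\<close>

text \<open>Row \<open>i\<close> is \<open>v\<close> itself, so row operations clear the multiples
  of \<open>v\<close> from the rows in \<open>S\<close>, one row per induction step.\<close>

lemma det_unit_rows_except_one:
  fixes v :: "real ^ 'n" and u :: "'n \<Rightarrow> real"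
  assumes "finite S" "i \<notin> S"
  shows "det (\<chi> k. if k = i then v else axis k 1 + (if k \<in> S then u k else 0) *s v) = v $ i"
  using assms
proof (induction S rule: finite_induct)
  case empty
  \<comment> \<open>The base case is Cramer's rule for the identity matrix, with \<open>v\<close>
    written as a combination of the unit rows.\<close>
  have "det ((\<chi> k. if k = i then sum (\<lambda>j. v $ j *s row j (mat 1)) UNIV else row k (mat 1)) :: real ^ 'n ^ 'n)
      = v $ i * det (mat 1 :: real ^ 'n ^ 'n)"
    by (rule cramer_lemma_transpose)
  moreover have row1: "row k (mat 1 :: real ^ 'n ^ 'n) = axis k 1" for k
    by (simp add: row_def mat_def axis_def vec_eq_iff)
  moreover have "(\<Sum>j\<in>UNIV. v $ j *s axis j 1) = v"
    by (rule basis_expansion)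
  ultimately show ?case
    by (simp add: if_distrib cong: if_cong)
next
  case (insert j S)
  let ?A = "(\<chi> k. if k = i then v else axis k 1 + (if k \<in> S then u k else 0) *s v) :: real ^ 'n ^ 'n"
  have "(\<chi> k. if k = i then v else axis k 1 + (if k \<in> insert j S then u k else 0) *s v)
      = (\<chi> k. if k = j then row j ?A + u j *s row i ?A else row k ?A)"
    using insert.hyps insert.prems by (auto simp: row_def vec_eq_iff)
  moreover have "det (\<chi> k. if k = j then row j ?A + u j *s row i ?A else row k ?A) = det ?A"
    using insert.prems by (intro det_row_operation) auto
  ultimately show ?case
    using insert.IH insert.prems by simp
qed

text \<open>Induction on the set \<open>S\<close> of rows that have received their multiple of
  \<open>v\<close>. By linearity in the new row \<open>i\<close>, the determinant gains
  \<open>u i\<close> times one whose row \<open>i\<close> is \<open>v\<close>, and that one equals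
  \<open>v $ i\<close>.\<close>

lemma det_rank_one_update_mat_1:
  fixes v :: "real ^ 'n" and u :: "'n \<Rightarrow> real"
  shows "det (\<chi> i j. (if i = j then 1 else 0) + u i * v $ j) = 1 + (\<Sum>i\<in>UNIV. u i * v $ i)"
proof -
  have "det (\<chi> k. axis k 1 + (if k \<in> S then u k else 0) *s v) = 1 + (\<Sum>i\<in>S. u i * v $ i)"
    if "finite S" for S
    using that
  proof (induction S rule: finite_induct)
    case empty
    have "(\<chi> k. axis k 1) = (mat 1 :: real ^ 'n ^ 'n)"
      by (simp add: mat_def axis_def vec_eq_iff)
    then show ?case by simp
  next
    case (insert i S)
    let ?c = "\<lambda>k. axis k 1 + (if k \<in> S then u k else 0) *s v"
    have "det (\<chi> k. axis k 1 + (if k \<in> insert i S then u k else 0) *s v)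
        = det (\<chi> k. if k = i then axis k 1 + u i *s v else ?c k)"
      by (intro arg_cong[where f = det]) (auto simp: vec_eq_iff)
    also have "\<dots> = det (\<chi> k. if k = i then axis k 1 else ?c k) +
        u i * det (\<chi> k. if k = i then v else ?c k)"
      using det_row_add[of i "\<lambda>k. axis k 1" "\<lambda>k. u i *s v" ?c]
        det_row_mul[of i "u i" "\<lambda>k. v" ?c] by simp
    also have "(\<chi> k. if k = i then axis k 1 else ?c k) = (\<chi> k. ?c k)"
      using insert.hyps by (auto simp: vec_eq_iff)
    finally show ?case
      using insert by (simp add: det_unit_rows_except_one)
  qed
  from this[of UNIV] show ?thesis
    by (simp add: axis_def plus_vec_def eq_commute)
qed

text \<open>Pulling \<open>d i\<close> out of row \<open>i\<close> leaves the identity plus a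
  rank-one matrix.\<close>

lemma det_diagonal_plus_rank_one:
  fixes d p q :: "'n::finite \<Rightarrow> real"
  assumes "\<And>i. d i \<noteq> 0"
  shows "det (\<chi> i j. (if i = j then d i else 0) + p i * q j)
    = (\<Prod>i\<in>UNIV. d i) * (1 + (\<Sum>i\<in>UNIV. p i * q i / d i))"
proof -
  let ?B = "\<chi> i j. (if i = j then 1 else 0) + p i / d i * (\<chi> j. q j) $ j"
  have "det (\<chi> i j. (if i = j then d i else 0) + p i * q j) = det (\<chi> i. d i *s ?B $ i)"
    using assms by (intro arg_cong[where f = det]) (auto simp: vec_eq_iff field_simps)
  then show ?thesis
    unfolding det_rows_mul by (subst (asm) vec_lambda_eta, subst (asm) det_rank_one_update_mat_1) (simp add: field_simps)
qed

section \<open>Elementary symmetric functions\<close>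

definition elem_sym :: "nat \<Rightarrow> ('n::finite \<Rightarrow> real) \<Rightarrow> real" where
  "elem_sym m x = (\<Sum>S | card S = m. \<Prod>i\<in>S. x i)"

lemma elem_sym_0 [simp]: "elem_sym 0 x = 1"
proof -
  have "{S :: 'a set. card S = 0} = {{}}"
    by auto
  then show ?thesis by (simp add: elem_sym_def)
qed

lemma sum_over_subsets_by_card:
  fixes f :: "'n::finite set \<Rightarrow> real"
  shows "(\<Sum>S\<in>UNIV. f S) = (\<Sum>m\<le>CARD('n). \<Sum>S | card S = m. f S)"
  using sum.group[of "UNIV :: 'n set set" "{..CARD('n)}" card f]
  by (simp add: card_mono image_subset_iff)

lemma prod_diff_elem_sym:
  fixes x :: "'n::finite \<Rightarrow> real"
  shows "(\<Prod>i\<in>UNIV. t - x i) = (\<Sum>m\<le>CARD('n). (- 1) ^ m * elem_sym m x * t ^ (CARD('n) - m))"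
proof -
  have "(\<Prod>i\<in>UNIV. t - x i)
      = (\<Sum>S\<in>UNIV. (- 1) ^ card S * (\<Prod>i\<in>S. x i) * (\<Prod>i\<in>UNIV - S. t))"
    by (subst prod_diff_conv_sum) auto
  also have "\<dots> = (\<Sum>S\<in>UNIV. (- 1) ^ card S * (\<Prod>i\<in>S. x i) * t ^ (CARD('n) - card S))"
    by (simp add: card_Diff_subset)
  finally show ?thesis
    by (simp add: sum_over_subsets_by_card elem_sym_def sum_distrib_left sum_distrib_right)
qed

lemma power_card_elem_sym:
  fixes x :: "'n::finite \<Rightarrow> real"
  shows "x j ^ CARD('n)
    = (\<Sum>k<CARD('n). - ((- 1) ^ (CARD('n) - k) * elem_sym (CARD('n) - k) x) * x j ^ k)"
proof -
  let ?n = "CARD('n)"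
  let ?f = "\<lambda>m. (- 1) ^ m * elem_sym m x * x j ^ (?n - m)"
  \<comment> \<open>The factor with \<open>i = j\<close> vanishes. Reversing the order of the
    expanded sum then puts the leading power last, where it splits off.\<close>
  have "0 = (\<Prod>i\<in>UNIV. x j - x i)"
    by (rule sym, rule prod_zero) auto
  also have "\<dots> = (\<Sum>m\<le>?n. ?f m)"
    by (rule prod_diff_elem_sym)
  also have "\<dots> = (\<Sum>k\<le>?n. ?f (?n - k))"
    by (rule sum.reindex_bij_witness[of _ "\<lambda>k. ?n - k" "\<lambda>k. ?n - k"]) auto
  also have "\<dots> = (\<Sum>k<?n. ?f (?n - k)) + x j ^ ?n"
    unfolding lessThan_Suc_atMost[symmetric] by simp
  finally have "x j ^ ?n = - (\<Sum>k<?n. ?f (?n - k))"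
    by simp
  also have "\<dots> = (\<Sum>k<?n. - ((- 1) ^ (?n - k) * elem_sym (?n - k) x) * x j ^ k)"
    unfolding sum_negf[symmetric] by (intro sum.cong) auto
  finally show ?thesis .
qed

section \<open>Permanent of the matrix with entries \<open>1 + x i * y j\<close>\<close>

text \<open>Equal cardinality passes to the complements, so a bijection from \<open>S\<close> to
  \<open>T\<close> can be glued to one between the complements.\<close>

lemma ex_permutes_image:
  fixes S T :: "'n::finite set"
  assumes "card S = card T"
  obtains \<pi> where "\<pi> permutes UNIV" "\<pi> ` S = T"
proof -
  from assms obtain f where f: "bij_betw f S T"
    using finite_same_card_bij[of S T] by auto
  from assms obtain g where g: "bij_betw g (- S) (- T)"
    using finite_same_card_bij[of "- S" "- T"] by (auto simp: Compl_eq_Diff_UNIV card_Diff_subset)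
  define h where "h = (\<lambda>i. if i \<in> S then f i else g i)"
  have h: "bij_betw h S T"
    using f by (rule bij_betw_cong[THEN iffD1, rotated]) (simp add: h_def)
  moreover have "bij_betw h (- S) (- T)"
    using g by (rule bij_betw_cong[THEN iffD1, rotated]) (simp add: h_def)
  ultimately have "bij_betw h (S \<union> - S) (T \<union> - T)"
    by (rule bij_betw_combine) auto
  then have "h permutes UNIV"
    by (intro bij_imp_permutes) auto
  moreover have "h ` S = T"
    using h by (simp add: bij_betw_def)
  ultimately show ?thesis by (rule that)
qed

text \<open>The sum over \<open>\<sigma>\<close> depends on \<open>S\<close> only through its cardinality, so it may be averaged over all \<open>S\<close> of that
size.\<close>

lemma sum_permutations_prod_image:
  fixes y :: "'n::finite \<Rightarrow> real"
  shows "real (CARD('n) choose card S) * (\<Sum>\<sigma> | \<sigma> permutes UNIV. \<Prod>i\<in>S. y (\<sigma> i))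
    = fact CARD('n) * elem_sym (card S) y"
proof -
  let ?F = "\<lambda>S. \<Sum>\<sigma> | \<sigma> permutes UNIV. \<Prod>i\<in>S. y (\<sigma> i)"
  have eq: "?F T = ?F S" if "card T = card S" for T
  proof -
    from that[symmetric] obtain \<pi> where \<pi>: "\<pi> permutes UNIV" "\<pi> ` S = T"
      by (rule ex_permutes_image)
    \<comment> \<open>Moving from \<open>T\<close> to \<open>S\<close> replaces \<sigma> by
      \<open>\<sigma> \<circ> \<pi>\<close>, which only reindexes the sum over all
      permutations.\<close>
    have "(\<Prod>i\<in>T. y (\<sigma> i)) = (\<Prod>i\<in>S. y ((\<sigma> \<circ> \<pi>) i))" for \<sigma>
      using \<pi> by (simp add: prod.reindex permutes_inj_on flip: \<pi>(2))
    then show ?thesis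
      using sum_permutations_compose_right[OF \<pi>(1), of "\<lambda>\<sigma>. \<Prod>i\<in>S. y (\<sigma> i)"] by simp
  qed
  \<comment> \<open>Each \<sigma> merely permutes the subsets of a given size, so the inner sum does
    not depend on it.\<close>
  have inner: "(\<Sum>T | card T = card S. \<Prod>i\<in>T. y (\<sigma> i)) = elem_sym (card S) y"
    if "\<sigma> permutes UNIV" for \<sigma>
  proof -
    have bij: "bij \<sigma>"
      using that by (rule permutes_bij)
    show ?thesis
      unfolding elem_sym_def
    proof (rule sum.reindex_bij_witness[of _ "\<lambda>T. inv \<sigma> ` T" "\<lambda>T. \<sigma> ` T"])
      fix T
      show "inv \<sigma> ` \<sigma> ` T = T" "\<sigma> ` inv \<sigma> ` T = T"
        using bij by (simp_all add: bij_is_inj bij_is_surj image_f_inv_f image_inv_f_f)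
      show "\<sigma> ` T \<in> {T. card T = card S}" if "T \<in> {T. card T = card S}"
        using that bij by (simp add: card_image bij_is_inj inj_on_subset[OF bij_is_inj])
      show "inv \<sigma> ` T \<in> {T. card T = card S}" if "T \<in> {T. card T = card S}"
        using that bij by (simp add: card_image inj_on_subset[OF bij_is_inj[OF bij_imp_bij_inv]])
      show "prod y (\<sigma> ` T) = (\<Prod>i\<in>T. y (\<sigma> i))"
        using bij by (simp add: prod.reindex inj_on_subset[OF bij_is_inj])
    qed
  qed
  have "real (CARD('n) choose card S) * ?F S = (\<Sum>T :: 'n set | card T = card S. ?F S)"
    using n_subsets[of "UNIV :: 'n set" "card S"] by simp
  also have "\<dots> = (\<Sum>T | card T = card S. ?F T)"
    by (rule sum.cong[OF refl], rule eq[symmetric]) simp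
  also have "\<dots> = (\<Sum>\<sigma> | \<sigma> permutes UNIV. \<Sum>T | card T = card S. \<Prod>i\<in>T. y (\<sigma> i))"
    by (rule sum.swap)
  also have "\<dots> = fact CARD('n) * elem_sym (card S) y"
    by (simp add: inner card_permutations)
  finally show ?thesis .
qed

text \<open>Expanding each product selects the set \<open>S\<close> of rows that contribute
  \<open>x i * y (\<sigma> i)\<close> rather than \<open>1\<close>. After the sums are exchanged,
  the sum over \<sigma> is known from \<open>card S\<close> alone.\<close>

lemma permanent_one_plus_outer:
  fixes x y :: "'n::finite \<Rightarrow> real"
  shows "permanent (\<chi> i j. 1 + x i * y j) = fact CARD('n) *
    (\<Sum>m\<le>CARD('n). elem_sym m x * elem_sym m y / real (CARD('n) choose m))"
proof -
  let ?n = "CARD('n)"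
  have card_le: "card S \<le> ?n" for S :: "'n set"
    by (simp add: card_mono)
  have "permanent (\<chi> i j. 1 + x i * y j)
      = (\<Sum>\<sigma> | \<sigma> permutes UNIV. \<Sum>S\<in>UNIV. (\<Prod>i\<in>S. x i) * (\<Prod>i\<in>S. y (\<sigma> i)))"
    unfolding permanent_def
  proof (rule sum.cong[OF refl])
    fix \<sigma> :: "'n \<Rightarrow> 'n"
    show "(\<Prod>i\<in>UNIV. (\<chi> i j. 1 + x i * y j) $ i $ \<sigma> i) = (\<Sum>S\<in>UNIV. (\<Prod>i\<in>S. x i) * (\<Prod>i\<in>S. y (\<sigma> i)))"
      using prod_add[of UNIV "\<lambda>i. x i * y (\<sigma> i)" "\<lambda>i. 1"] by (simp add: add.commute prod.distrib)
  qed
  also have "\<dots> = (\<Sum>S\<in>UNIV. (\<Prod>i\<in>S. x i) * (\<Sum>\<sigma> | \<sigma> permutes UNIV. \<Prod>i\<in>S. y (\<sigma> i)))"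
    by (subst sum.swap) (simp add: sum_distrib_left)
  also have "\<dots> = (\<Sum>S\<in>UNIV. (\<Prod>i\<in>S. x i) * (fact ?n * elem_sym (card S) y / real (?n choose card S)))"
  proof (intro sum.cong refl arg_cong2[where f = "(*)"])
    fix S :: "'n set"
    show "(\<Sum>\<sigma> | \<sigma> permutes UNIV. \<Prod>i\<in>S. y (\<sigma> i)) = fact ?n * elem_sym (card S) y / real (?n choose card S)"
      using sum_permutations_prod_image[of S y] card_le[of S] by (simp add: field_simps)
  qed
  also have "\<dots> = (\<Sum>m\<le>?n. fact ?n * (elem_sym m x * elem_sym m y / real (?n choose m)))"
    unfolding sum_over_subsets_by_card
    by (rule sum.cong[OF refl]) (simp add: elem_sym_def[of _ x] sum_distrib_left sum_distrib_right sum_divide_distrib mult_ac)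
  finally show ?thesis
    by (simp add: sum_distrib_left)
qed

section \<open>The identity for the matrix with entries \<open>1 + x i * y j\<close>\<close>

text \<open>Compares the diagonal parts of the two middle factors. Each factor \<open>n\<close> is
  absorbed by \<open>n * ((n - 1) choose k) = (n - k) * (n choose k)\<close>, and the numbers
  \<open>n - k\<close> multiply to \<open>n!\<close>.\<close>

lemma prod_binomial_ratio:
  "real n ^ n * (\<Prod>k<n. real ((n - 1) choose k)) = fact n * (\<Prod>k<n. real (n choose k))"
proof -
  have "real n ^ n * (\<Prod>k<n. real ((n - 1) choose k)) = (\<Prod>k<n. real n * real ((n - 1) choose k))"
    by (simp add: prod.distrib)
  also have "\<dots> = (\<Prod>k<n. real (n - k) * real (n choose k))"
  proof (rule prod.cong[OF refl])
    fix k assume "k \<in> {..<n}"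
    then show "real n * real ((n - 1) choose k) = real (n - k) * real (n choose k)"
      using binomial_absorb_comp[of n k] by (metis of_nat_mult)
  qed
  also have "\<dots> = (\<Prod>k<n. real (n - k)) * (\<Prod>k<n. real (n choose k))"
    by (rule prod.distrib)
  also have "(\<Prod>k<n. real (n - k)) = (\<Prod>k = 1..n. real k)"
    by (rule prod.reindex_bij_witness[of _ "\<lambda>k. n - k" "\<lambda>k. n - k"]) auto
  also have "\<dots> = fact n"
    by (simp add: fact_prod)
  finally show ?thesis .
qed

lemma det_hadamard_power_one_plus_outer:
  fixes x y :: "'n::finite \<Rightarrow> real"
  defines "X \<equiv> (\<chi> i j. 1 + x i * y j) :: real ^ 'n ^ 'n"
  shows "(fact CARD('n))\<^sup>2 * det (hadamard_power X CARD('n)) =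
    real CARD('n) ^ CARD('n) * det (hadamard_power X (CARD('n) - 1)) * permanent X"
proof -
  let ?n = "CARD('n)"
  \<comment> \<open>The numbering \<open>h\<close> lets the abstract index type serve as the set of
    exponents below \<open>n\<close>.\<close>
  obtain h :: "'n \<Rightarrow> nat" where "bij_betw h UNIV {0..<?n}"
    using ex_bij_betw_finite_nat[of "UNIV :: 'n set"] by auto
  then have h: "bij_betw h UNIV {..<?n}"
    by (simp add: atLeast0LessThan)
  have h_less: "h i < ?n" for i
    using h by (auto simp: bij_betw_def)
  have h_eq: "h i = h j \<longleftrightarrow> i = j" for i j
    using h by (auto simp: bij_betw_def inj_on_def)
  note sum_h = sum.reindex_bij_betw[OF h] and prod_h = prod.reindex_bij_betw[OF h]
  define V where "V z = ((\<chi> i k. z i ^ h k) :: real ^ 'n ^ 'n)" for z :: "'n \<Rightarrow> real"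
  \<comment> \<open>The coefficients expressing \<open>z i ^ n\<close> through lower powers of
    \<open>z i\<close>, the same for every \<open>i\<close>.\<close>
  define c where "c z k = - ((- 1) ^ (?n - h k) * elem_sym (?n - h k) z)" for z :: "'n \<Rightarrow> real" and k
  define D where "D = ((\<chi> i j. (if i = j then real ((?n - 1) choose h i) else 0)) :: real ^ 'n ^ 'n)"
  \<comment> \<open>The middle factor for the power \<open>n\<close>: the diagonal holds the
    binomial terms of exponent below \<open>n\<close>, and the rank-one part is the top term
    rewritten through \<open>c\<close>.\<close>
  define E where "E = ((\<chi> i j. (if i = j then real (?n choose h i) else 0) + c x i * c y j) :: real ^ 'n ^ 'n)"
  have pow_n: "z i ^ ?n = (\<Sum>k\<in>UNIV. c z k * z i ^ h k)" for z i
    unfolding power_card_elem_sym[of z i] c_def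
    by (rule sum_h[symmetric, where g = "\<lambda>k. - ((- 1) ^ (?n - k) * elem_sym (?n - k) z) * z i ^ k"])
  have "hadamard_power X (?n - 1) = V x ** D ** transpose (V y)"
  proof -
    have "(1 + x i * y j) ^ (?n - 1) = (\<Sum>k\<in>UNIV. x i ^ h k * real ((?n - 1) choose h k) * y j ^ h k)" for i j
    proof -
      have "(x i * y j + 1) ^ (?n - 1) = (\<Sum>k<?n. real ((?n - 1) choose k) * (x i * y j) ^ k)"
        by (simp add: binomial_ring flip: lessThan_Suc_atMost)
      then show ?thesis
        by (simp add: add.commute power_mult_distrib mult_ac flip: sum_h)
    qed
    then show ?thesis
      by (simp add: vec_eq_iff hadamard_power_def X_def V_def D_def matrix_matrix_mult_def transpose_def
          if_distrib[of "\<lambda>u. _ * u"] cong: if_cong)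
  qed
  then have "det (hadamard_power X (?n - 1)) = det (V x) * det D * det (V y)"
    by (simp add: det_mul)
  also have "det D = (\<Prod>k<?n. real ((?n - 1) choose k))"
    by (subst det_diagonal) (simp_all add: D_def flip: prod_h)
  finally have det_pred: "det (hadamard_power X (?n - 1)) =
      det (V x) * (\<Prod>k<?n. real ((?n - 1) choose k)) * det (V y)" .

  have "hadamard_power X ?n = V x ** E ** transpose (V y)"
  proof -
    have "(1 + x i * y j) ^ ?n
      = (\<Sum>l\<in>UNIV. (\<Sum>k\<in>UNIV. x i ^ h k * E $ k $ l) * y j ^ h l)" for i j
    proof -
      have "(x i * y j + 1) ^ ?n = (\<Sum>k<?n. real (?n choose k) * (x i * y j) ^ k) + x i ^ ?n * y j ^ ?n"
        by (simp add: binomial_ring power_mult_distrib flip: lessThan_Suc_atMost)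
      also have "\<dots> = (\<Sum>l\<in>UNIV. x i ^ h l * real (?n choose h l) * y j ^ h l) +
          (\<Sum>l\<in>UNIV. (\<Sum>k\<in>UNIV. x i ^ h k * (c x k * c y l)) * y j ^ h l)"
      proof (rule arg_cong2[where f = "(+)"])
        show "(\<Sum>k<?n. real (?n choose k) * (x i * y j) ^ k) = (\<Sum>l\<in>UNIV. x i ^ h l * real (?n choose h l) * y j ^ h l)"
          by (simp add: power_mult_distrib mult_ac flip: sum_h)
        show "x i ^ ?n * y j ^ ?n = (\<Sum>l\<in>UNIV. (\<Sum>k\<in>UNIV. x i ^ h k * (c x k * c y l)) * y j ^ h l)"
          unfolding pow_n sum_product by (subst sum.swap) (simp add: sum_distrib_left sum_distrib_right mult_ac)
      qed
      finally show ?thesis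
        by (simp add: E_def add.commute[of 1] distrib_left distrib_right sum.distrib
          if_distrib[of "\<lambda>u. _ * u"] cong: if_cong)
    qed
    then show ?thesis
      by (simp add: vec_eq_iff hadamard_power_def X_def V_def matrix_matrix_mult_def transpose_def)
  qed
  then have "det (hadamard_power X ?n) = det (V x) * det E * det (V y)"
    by (simp add: det_mul)
  also have "det E = (\<Prod>k<?n. real (?n choose k)) *
      (\<Sum>m\<le>?n. elem_sym m x * elem_sym m y / real (?n choose m))"
  proof -
    let ?g = "\<lambda>m. elem_sym m x * elem_sym m y / real (?n choose m)"
    have "det E = (\<Prod>i\<in>UNIV. real (?n choose h i)) * (1 + (\<Sum>i\<in>UNIV. c x i * c y i / real (?n choose h i)))"
      unfolding E_def using h_less by (intro det_diagonal_plus_rank_one) (simp add: not_less less_imp_le)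
    also have "(\<Sum>i\<in>UNIV. c x i * c y i / real (?n choose h i)) = (\<Sum>i\<in>UNIV. ?g (?n - h i))"
    proof (rule sum.cong[OF refl])
      fix i
      \<comment> \<open>The signs in \<open>c x\<close> and \<open>c y\<close> have the same
        exponent, so they cancel.\<close>
      have "(- 1) ^ (?n - h i) * (- 1) ^ (?n - h i) = (1 :: real)"
        by (simp flip: power_mult_distrib)
      then show "c x i * c y i / real (?n choose h i) = ?g (?n - h i)"
        using binomial_symmetric[of "h i" ?n] h_less[of i] by (simp add: c_def mult_ac)
    qed
    also have "\<dots> = (\<Sum>k<?n. ?g (?n - k))"
      by (rule sum_h)
    \<comment> \<open>The summand \<open>1\<close> is the missing term \<open>k = n\<close>, namely
      \<open>?g 0\<close>.\<close>
    also have "1 + \<dots> = (\<Sum>k\<le>?n. ?g (?n - k))"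
      unfolding lessThan_Suc_atMost[symmetric] by simp
    also have "\<dots> = (\<Sum>m\<le>?n. ?g m)"
      by (rule sum.reindex_bij_witness[of _ "\<lambda>k. ?n - k" "\<lambda>k. ?n - k"]) auto
    finally show ?thesis
      by (simp only: prod_h[where g = "\<lambda>k. real (?n choose k)"])
  qed
  finally have "fact ?n * det (hadamard_power X ?n) =
      det (V x) * (\<Prod>k<?n. real (?n choose k)) * permanent X * det (V y)"
    by (simp add: X_def permanent_one_plus_outer)
  \<comment> \<open>One factorial went into the permanent; the second turns the binomial product
    into the one for \<open>n - 1\<close>, which yields the factor \<open>n ^ n\<close>.\<close>
  then have "(fact ?n)\<^sup>2 * det (hadamard_power X ?n) =
      det (V x) * (fact ?n * (\<Prod>k<?n. real (?n choose k))) * permanent X * det (V y)"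
    by (simp add: power2_eq_square)
  then show ?thesis
    by (simp only: det_pred prod_binomial_ratio[symmetric] mult_ac)
qed

section \<open>Rescaling, perturbation and the general case\<close>

lemma prod_scale_permutes:
  fixes a b :: "'n::finite \<Rightarrow> 'a::comm_monoid_mult"
  assumes "\<sigma> permutes UNIV"
  shows "(\<Prod>i\<in>UNIV. a i * b (\<sigma> i) * f i) = (\<Prod>i\<in>UNIV. a i) * (\<Prod>j\<in>UNIV. b j) * (\<Prod>i\<in>UNIV. f i)"
  using prod.permute[OF assms, of b] by (simp add: prod.distrib o_def)

lemma permanent_scale_rows_columns:
  "permanent (\<chi> i j. a i * b j * A $ i $ j) = (\<Prod>i\<in>UNIV. a i) * (\<Prod>j\<in>UNIV. b j) * permanent A"
  unfolding permanent_def sum_distrib_left by (intro sum.cong) (simp_all add: prod_scale_permutes[of _ a b])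

lemma det_scale_rows_columns:
  fixes A :: "'a::comm_ring_1 ^ 'n ^ 'n"
  shows "det (\<chi> i j. a i * b j * A $ i $ j) = (\<Prod>i\<in>UNIV. a i) * (\<Prod>j\<in>UNIV. b j) * det A"
  unfolding det_def sum_distrib_left
  by (intro sum.cong) (simp_all add: prod_scale_permutes[of _ a b] mult.left_commute[of "of_int _"])

lemma det_hadamard_power_nonzero_outer:
  fixes a b c d :: "'n::finite \<Rightarrow> real"
  assumes "\<And>i. c i \<noteq> 0" "\<And>j. d j \<noteq> 0"
  defines "X \<equiv> (\<chi> i j. a i * b j + c i * d j) :: real ^ 'n ^ 'n"
  shows "(fact CARD('n))\<^sup>2 * det (hadamard_power X CARD('n)) =
    real CARD('n) ^ CARD('n) * det (hadamard_power X (CARD('n) - 1)) * permanent X"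
proof -
  let ?n = "CARD('n)"
  define Y where "Y = ((\<chi> i j. 1 + (a i / c i) * (b j / d j)) :: real ^ 'n ^ 'n)"
  define P where "P = (\<Prod>i\<in>UNIV. c i) * (\<Prod>j\<in>UNIV. d j)"
  have X: "X = (\<chi> i j. c i * d j * Y $ i $ j)"
    using assms(1,2) by (simp add: X_def Y_def vec_eq_iff field_simps)
  have det_X: "det (hadamard_power X k) = P ^ k * det (hadamard_power Y k)" for k
  proof -
    have "hadamard_power X k = (\<chi> i j. c i ^ k * d j ^ k * hadamard_power Y k $ i $ j)"
      by (simp add: X hadamard_power_def power_mult_distrib)
    then show ?thesis
      by (simp add: det_scale_rows_columns P_def prod_power_distrib power_mult_distrib)
  qed
  \<comment> \<open>Both sides scale alike: \<open>P ^ n\<close> on the left, and on the right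
    \<open>P ^ (n - 1)\<close> from the determinant times \<open>P\<close> from the
    permanent.\<close>
  have "P ^ ?n = P ^ (?n - 1) * P"
    by (simp only: power_minus_mult zero_less_card_finite)
  moreover have "permanent X = P * permanent Y"
    unfolding X permanent_scale_rows_columns P_def ..
  moreover have "(fact ?n)\<^sup>2 * det (hadamard_power Y ?n) =
      real ?n ^ ?n * det (hadamard_power Y (?n - 1)) * permanent Y"
    unfolding Y_def by (rule det_hadamard_power_one_plus_outer)
  ultimately show ?thesis
    unfolding det_X by (metis (no_types, lifting) mult.assoc mult.commute mult.left_commute)
qed

lemma det_hadamard_power_outer:
  fixes a b c d :: "'n::finite \<Rightarrow> real"
  defines "X \<equiv> (\<chi> i j. a i * b j + c i * d j) :: real ^ 'n ^ 'n"
  shows "(fact CARD('n))\<^sup>2 * det (hadamard_power X CARD('n)) =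
    real CARD('n) ^ CARD('n) * det (hadamard_power X (CARD('n) - 1)) * permanent X"
proof -
  let ?n = "CARD('n)"
  \<comment> \<open>One common shift suffices: only finitely many \<open>t\<close> make some
    \<open>c i + t\<close> or \<open>d j + t\<close> vanish.\<close>
  define Y where "Y t = ((\<chi> i j. a i * b j + (c i + t) * (d j + t)) :: real ^ 'n ^ 'n)" for t
  define F where "F t = (fact ?n)\<^sup>2 * det (hadamard_power (Y t) ?n) -
    real ?n ^ ?n * det (hadamard_power (Y t) (?n - 1)) * permanent (Y t)" for t
  have "isCont F 0"
    unfolding F_def Y_def det_def hadamard_power_def permanent_def
    by (simp, intro continuous_intros)
  then have "(F \<longlongrightarrow> F 0) (at 0)"
    by (simp add: isCont_def)
  moreover have "eventually (\<lambda>t. F t = 0) (at 0)"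
  proof -
    have ev: "eventually (\<lambda>t. \<forall>i\<in>UNIV. z i + t \<noteq> 0) (at 0)" for z :: "'n \<Rightarrow> real"
    proof (rule eventually_ball_finite)
      show "\<forall>i\<in>UNIV. eventually (\<lambda>t. z i + t \<noteq> 0) (at 0)"
      proof
        fix i
        show "eventually (\<lambda>t. z i + t \<noteq> 0) (at 0)"
          \<comment> \<open>The filter \<open>at 0\<close> omits \<open>0\<close> itself, which
            covers the case \<open>z i = 0\<close>.\<close>
          using eventually_neq_at_within[of "- z i" 0 UNIV] by eventually_elim auto
      qed
    qed simp
    from ev[of c] ev[of d] show ?thesis
    proof eventually_elim
      case (elim t)
      then show ?case
        using det_hadamard_power_nonzero_outer[of "\<lambda>i. c i + t" "\<lambda>j. d j + t" a b]
        by (simp add: F_def Y_def)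
    qed
  qed
  then have "(F \<longlongrightarrow> 0) (at 0)"
    by (rule tendsto_eventually)
  ultimately have "F 0 = 0"
    by (rule tendsto_unique[rotated]) simp
  then show ?thesis
    by (simp add: F_def Y_def X_def)
qed

theorem theorem9:
  fixes X :: "real ^ 'n ^ 'n"
  assumes "rank X = 2"
  shows "(fact CARD('n))\<^sup>2 * det (hadamard_power X CARD('n)) =
    real CARD('n) ^ CARD('n) * det (hadamard_power X (CARD('n) - 1)) * permanent X"
proof -
  \<comment> \<open>The row space has a basis of two vectors; the coordinates of the rows in this
    basis supply the column factors of the outer-product form.\<close>
  obtain B where B: "rows X \<subseteq> span B" "card B = dim (rows X)"
    by (rule basis_exists[of "rows X"])
  then obtain u v where "B = {u, v}"
    using assms by (auto simp: row_rank_def card_2_iff)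
  then have "\<exists>\<alpha> \<beta>. row i X = \<alpha> *\<^sub>R u + \<beta> *\<^sub>R v" for i
    using B(1) by (auto simp: span_insert rows_def eq_diff_eq span_singleton algebra_simps; metis)
  then obtain \<alpha> \<beta> where "\<And>i. row i X = \<alpha> i *\<^sub>R u + \<beta> i *\<^sub>R v"
    by metis
  then have "X = (\<chi> i j. \<alpha> i * u $ j + \<beta> i * v $ j)"
    by (simp add: vec_eq_iff row_def)
  then show ?thesis
    using det_hadamard_power_outer[of \<alpha> "($) u" \<beta> "($) v"] by simp
qed

end
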